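(* Let $G$ be a locally compact group and $N$ be a compact normal subgroup of $G$. Suppose $\xi\in\Gamma(G,N)$ and $\psi,\phi\in\mathcal{C}_\xi(G,N)$. Then $$\psi\ast_G\phi=\lambda_N(N)\,\psi\natural\phi.$$
   Context: Fix left Haar measures $\lambda_G$ on $G$ and $\lambda_N$ on $N$, and let $\lambda_{G/N}$ be the left Haar measure on $G/N$ normalized by Weil's formula $\int_{G/N}\int_N f(xs)\,d\lambda_N(s)\,d\lambda_{G/N}(xN)=\int_G f\,d\lambda_G$ for $f\in L^1(G)$. A character of $N$ is a continuous homomorphism $\xi:N\to\mathbb{T}=\{z\in\mathbb{C}:|z|=1\}$. $\Gamma(G,N)$ is the set of $G$-invariant characters of $N$: those $\xi$ with $\xi(x^{-1}sx)=\xi(s)$ for all $x\in G$, $s\in N$. For a character $\xi$, $\mathcal{C}_\xi(G,N)$ is the space of continuous $\psi:G\to\mathbb{C}$ such that $\psi(xs)=\xi(s)\psi(x)$ for all $x\in G$, $s\in N$ and the image of $\mathrm{supp}(\psi)$ under the quotient map $G\to G/N$ is compact (for compact $N$, $\mathcal{C}_\xi(G,N)\subseteq\mathcal{C}_c(G)$). For $\psi,\phi\in\mathcal{C}_\xi(G,N)$ the covariant convolution is $\psi\natural\phi(x)=\int_{G/N}\psi(y)\phi(y^{-1}x)\,d\lambda_{G/N}(yN)$, $x\in G$ (the integrand depends only on the coset $yN$). The convolution on $G$ is $f\ast_G g(x)=\int_G f(y)g(y^{-1}x)\,d\lambda_G(y)$. *)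

theory Defs
  imports "HOL-Analysis.Analysis" "HOL-Algebra.Coset"
begin

locale topological_group = group G for G :: "('a, 'b) monoid_scheme" (structure) +
  fixes T :: "'a topology"
  assumes topspace_eq_carrier: "topspace T = carrier G"
    and continuous_mult: "continuous_map (prod_topology T T) T (\<lambda>(x, y). x \<otimes> y)"
    and continuous_inv: "continuous_map T T (\<lambda>x. inv x)"

text \<open>Locally compact groups are Hausdorff by convention.\<close>

locale locally_compact_group = topological_group +
  assumes locally_compact: "locally_compact_space T"
    and Hausdorff: "Hausdorff_space T"

definition quotient_topology :: "'a topology \<Rightarrow> ('a \<Rightarrow> 'c) \<Rightarrow> 'c topology" where
  "quotient_topology T q =
     topology (\<lambda>U. U \<subseteq> q ` topspace T \<and> openin T {x \<in> topspace T. q x \<in> U})"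

lemma openin_quotient_topology:
  "openin (quotient_topology T q) U \<longleftrightarrow>
     U \<subseteq> q ` topspace T \<and> openin T {x \<in> topspace T. q x \<in> U}"
proof -
  have "istopology (\<lambda>U. U \<subseteq> q ` topspace T \<and> openin T {x \<in> topspace T. q x \<in> U})"
    unfolding istopology_def
  proof (intro conjI allI impI)
    fix S U
    assume *: "S \<subseteq> q ` topspace T \<and> openin T {x \<in> topspace T. q x \<in> S}"
      "U \<subseteq> q ` topspace T \<and> openin T {x \<in> topspace T. q x \<in> U}"
    have "{x \<in> topspace T. q x \<in> S \<inter> U} =
        {x \<in> topspace T. q x \<in> S} \<inter> {x \<in> topspace T. q x \<in> U}" by auto
    with * show "openin T {x \<in> topspace T. q x \<in> S \<inter> U}" by (simp add: openin_Int)
    show "S \<inter> U \<subseteq> q ` topspace T" using * by auto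
  next
    fix \<K>
    assume *: "\<forall>K\<in>\<K>. K \<subseteq> q ` topspace T \<and> openin T {x \<in> topspace T. q x \<in> K}"
    have "{x \<in> topspace T. q x \<in> \<Union>\<K>} = (\<Union>K\<in>\<K>. {x \<in> topspace T. q x \<in> K})" by auto
    with * show "openin T {x \<in> topspace T. q x \<in> \<Union>\<K>}" by auto
    show "\<Union>\<K> \<subseteq> q ` topspace T" using * by auto
  qed
  then show ?thesis by (simp add: quotient_topology_def topology_inverse')
qed

lemma topspace_quotient_topology: "topspace (quotient_topology T q) = q ` topspace T"
proof -
  have "openin (quotient_topology T q) (q ` topspace T)"
    using openin_topspace[of T] by (auto simp: openin_quotient_topology cong: conj_cong
        intro: back_subst[where P = "openin T"])
  then show ?thesis
    by (metis openin_quotient_topology openin_subset openin_topspace subset_antisym)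
qed

lemma quotient_map_quotient_topology: "quotient_map T (quotient_topology T q) q"
  by (auto simp: quotient_map_def topspace_quotient_topology openin_quotient_topology)

text \<open>For normal \<open>N\<close> the left cosets \<open>xN\<close> used here are the elements of \<open>carrier (G Mod N)\<close>,
  which the library defines through right cosets.\<close>

definition coset_topology ::
  "('a, 'b) monoid_scheme \<Rightarrow> 'a topology \<Rightarrow> 'a set \<Rightarrow> 'a set topology" where
  "coset_topology G T N = quotient_topology T (\<lambda>x. x <#\<^bsub>G\<^esub> N)"

lemma (in topological_group) topspace_coset_topology:
  assumes "N \<lhd> G"
  shows "topspace (coset_topology G T N) = carrier (G Mod N)"
  using normal.coset_eq[OF assms]
  by (auto simp: coset_topology_def topspace_quotient_topology topspace_eq_carrier
      FactGroup_def RCOSETS_def)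

definition borel_of :: "'a topology \<Rightarrow> 'a measure" where
  "borel_of T = sigma (topspace T) {U. openin T U}"

text \<open>Radon measures in the sense usual for Haar measure: Borel, finite on compact sets, outer
  regular on Borel sets, inner regular on open sets.\<close>

definition radon_measure :: "'a topology \<Rightarrow> 'a measure \<Rightarrow> bool" where
  "radon_measure T M \<longleftrightarrow>
     sets M = sets (borel_of T) \<and>
     (\<forall>K. compactin T K \<longrightarrow> emeasure M K < \<infinity>) \<and>
     (\<forall>A\<in>sets M. emeasure M A = (INF U\<in>{U. openin T U \<and> A \<subseteq> U}. emeasure M U)) \<and>
     (\<forall>U. openin T U \<longrightarrow> emeasure M U = (SUP K\<in>{K. compactin T K \<and> K \<subseteq> U}. emeasure M K))"

definition left_haar_measure ::
  "('a, 'b) monoid_scheme \<Rightarrow> 'a topology \<Rightarrow> 'a measure \<Rightarrow> bool" where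
  "left_haar_measure G T M \<longleftrightarrow>
     radon_measure T M \<and> emeasure M (space M) \<noteq> 0 \<and>
     (\<forall>x\<in>carrier G. \<forall>A\<in>sets M. emeasure M (x <#\<^bsub>G\<^esub> A) = emeasure M A)"

text \<open>The function on cosets induced by \<open>F\<close>. It is only used for \<open>F\<close> that are constant on the
  cosets, so that the choice of the representative is immaterial.\<close>

definition on_cosets :: "('a \<Rightarrow> 'c) \<Rightarrow> 'a set \<Rightarrow> 'c" where
  "on_cosets F C = F (SOME y. y \<in> C)"

lemma (in group) on_cosets_eq:
  assumes "subgroup N G" "x \<in> carrier G" "\<And>s. s \<in> N \<Longrightarrow> F (x \<otimes> s) = F x"
  shows "on_cosets F (x <# N) = F x"
proof -
  have "x \<otimes> \<one> \<in> x <# N"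
    using subgroup.one_closed[OF assms(1)] by (auto simp: l_coset_def)
  then have "(SOME y. y \<in> x <# N) \<in> x <# N" by (rule someI)
  then show ?thesis using assms(3) by (auto simp: on_cosets_def l_coset_def)
qed

text \<open>Weil's formula. The inner integral depends only on the coset of \<open>x\<close> because \<open>\<mu>N\<close> is
  left invariant.\<close>

definition weil_formula ::
  "('a, 'b) monoid_scheme \<Rightarrow> 'a measure \<Rightarrow> 'a measure \<Rightarrow> 'a set measure \<Rightarrow> bool" where
  "weil_formula G \<mu>G \<mu>N \<mu>Q \<longleftrightarrow>
     (\<forall>f :: 'a \<Rightarrow> complex. integrable \<mu>G f \<longrightarrow>
        (\<integral>C. on_cosets (\<lambda>x. \<integral>s. f (x \<otimes>\<^bsub>G\<^esub> s) \<partial>\<mu>N) C \<partial>\<mu>Q) = (\<integral>x. f x \<partial>\<mu>G))"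

definition circle_group :: "complex monoid" where
  "circle_group = \<lparr>carrier = sphere 0 1, mult = (*), one = 1\<rparr>"

definition characters :: "('a, 'b) monoid_scheme \<Rightarrow> 'a topology \<Rightarrow> ('a \<Rightarrow> complex) set" where
  "characters G T =
     {\<xi> \<in> hom G circle_group. continuous_map T (top_of_set (sphere 0 1)) \<xi>}"

definition invariant_characters ::
  "('a, 'b) monoid_scheme \<Rightarrow> 'a topology \<Rightarrow> 'a set \<Rightarrow> ('a \<Rightarrow> complex) set" where
  "invariant_characters G T N =
     {\<xi> \<in> characters (G\<lparr>carrier := N\<rparr>) (subtopology T N).
        \<forall>x\<in>carrier G. \<forall>s\<in>N. \<xi> (inv\<^bsub>G\<^esub> x \<otimes>\<^bsub>G\<^esub> s \<otimes>\<^bsub>G\<^esub> x) = \<xi> s}"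

definition covariant_functions ::
  "('a, 'b) monoid_scheme \<Rightarrow> 'a topology \<Rightarrow> 'a set \<Rightarrow> ('a \<Rightarrow> complex) \<Rightarrow> ('a \<Rightarrow> complex) set" where
  "covariant_functions G T N \<xi> =
     {\<psi>. continuous_map T euclidean \<psi> \<and>
         (\<forall>x\<in>carrier G. \<forall>s\<in>N. \<psi> (x \<otimes>\<^bsub>G\<^esub> s) = \<xi> s * \<psi> x) \<and>
         compactin (coset_topology G T N)
           ((\<lambda>x. x <#\<^bsub>G\<^esub> N) ` (T closure_of {x \<in> carrier G. \<psi> x \<noteq> 0}))}"

definition group_convolution ::
  "('a, 'b) monoid_scheme \<Rightarrow> 'a measure \<Rightarrow> ('a \<Rightarrow> complex) \<Rightarrow> ('a \<Rightarrow> complex) \<Rightarrow> 'a \<Rightarrow> complex" where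
  "group_convolution G \<mu>G f g x = (\<integral>y. f y * g (inv\<^bsub>G\<^esub> y \<otimes>\<^bsub>G\<^esub> x) \<partial>\<mu>G)"

definition covariant_convolution ::
  "('a, 'b) monoid_scheme \<Rightarrow> 'a set measure \<Rightarrow> ('a \<Rightarrow> complex) \<Rightarrow> ('a \<Rightarrow> complex) \<Rightarrow> 'a \<Rightarrow> complex" where
  "covariant_convolution G \<mu>Q \<psi> \<phi> x =
     (\<integral>C. on_cosets (\<lambda>y. \<psi> y * \<phi> (inv\<^bsub>G\<^esub> y \<otimes>\<^bsub>G\<^esub> x)) C \<partial>\<mu>Q)"

end

theory Submission
  imports Defs
begin

text \<open>
  The idea is to apply Weil's formula to the integrand \<open>f y = \<psi> y * \<phi> (y\<inverse> x)\<close> of the convolution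
  on \<open>G\<close>. Replacing \<open>y\<close> by \<open>y s\<close> with \<open>s\<close> in \<open>N\<close> multiplies the first factor by \<open>\<xi> s\<close>. In the second
  factor it gives \<open>s\<inverse> y\<inverse> x = (y\<inverse> x) t\<close>, where \<open>t\<close> is the conjugate of \<open>s\<inverse>\<close> by \<open>y\<inverse> x\<close>; by invariance
  of \<open>\<xi>\<close> that factor is multiplied by \<open>\<xi> t = (\<xi> s)\<inverse>\<close>. So \<open>f\<close> is constant on cosets
  (\<open>covariant_product_coset_invariant\<close>), the inner integral over \<open>N\<close> in Weil's formula is the constant
  \<open>f y\<close> times the total mass of \<open>N\<close>, and this mass factors out of the integral over \<open>G/N\<close>.

  Weil's formula requires \<open>f\<close> to be integrable, and this is where compactness of \<open>N\<close> enters: it makes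
  the quotient map proper (\<open>proper_map_coset\<close>), so that a covariant function, whose support is
  only assumed to be compact modulo \<open>N\<close>, has compact support in \<open>G\<close>. Hence \<open>f\<close> is continuous with
  compact support.
\<close>

section \<open>Compact subgroups and the quotient map\<close>

lemma (in topological_group) continuous_map_mult_pair:
  assumes "continuous_map X T f" "continuous_map X T g"
  shows "continuous_map X T (\<lambda>z. f z \<otimes> g z)"
  using continuous_map_compose[OF continuous_map_pairedI[OF assms] continuous_mult]
  by (simp add: o_def)

lemma (in topological_group) compactin_l_coset:
  assumes "compactin T N" "x \<in> carrier G"
  shows "compactin T (x <# N)"
proof -
  have "continuous_map T T (\<lambda>s. x \<otimes> s)"
    using assms(2) by (intro continuous_map_mult_pair) (auto simp: topspace_eq_carrier)
  moreover have "x <# N = (\<lambda>s. x \<otimes> s) ` N" by (auto simp: l_coset_def)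
  ultimately show ?thesis using image_compactin[OF assms(1)] by metis
qed

text \<open>The saturation of \<open>C\<close> is the projection to the first factor of
  the closed set of pairs \<open>(x, s)\<close> with \<open>x s \<in> C\<close>, and projecting along a compact factor
  preserves closedness.\<close>

lemma (in topological_group) closedin_saturation:
  assumes N: "subgroup N G" "compactin T N" and C: "closedin T C"
  shows "closedin T {x \<in> carrier G. x <# N \<in> (\<lambda>y. y <# N) ` C}"
proof -
  let ?N = "subtopology T N"
  let ?P = "prod_topology T ?N"
  have N_carrier: "N \<subseteq> carrier G" and C_carrier: "C \<subseteq> carrier G"
    using subgroup.subset[OF N(1)] closedin_subset[OF C] by (auto simp: topspace_eq_carrier)
  have space: "topspace ?P = carrier G \<times> N"
    using N_carrier by (auto simp: topspace_eq_carrier topspace_subtopology)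
  have "continuous_map ?P T (\<lambda>z. fst z \<otimes> snd z)"
    using continuous_map_snd[of T ?N]
    by (intro continuous_map_mult_pair continuous_map_fst) (simp add: continuous_map_in_subtopology)
  then have "closedin ?P {z \<in> topspace ?P. fst z \<otimes> snd z \<in> C}"
    using C by (rule closedin_continuous_map_preimage)
  moreover have "closed_map ?P T fst"
    using N(2) by (intro closed_map_fst) (simp add: compact_space_subtopology)
  ultimately have "closedin T (fst ` {z \<in> topspace ?P. fst z \<otimes> snd z \<in> C})"
    by (simp add: closed_map_def)
  moreover have "fst ` {z \<in> topspace ?P. fst z \<otimes> snd z \<in> C}
      = {x \<in> carrier G. x <# N \<in> (\<lambda>y. y <# N) ` C}"
  proof (intro Set.set_eqI iffI)
    fix x assume "x \<in> fst ` {z \<in> topspace ?P. fst z \<otimes> snd z \<in> C}"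
    then obtain s where s: "x \<in> carrier G" "s \<in> N" "x \<otimes> s \<in> C"
      unfolding space by auto
    then have "x \<otimes> s \<in> x <# N" by (auto simp: l_coset_def)
    then have "x <# N = (x \<otimes> s) <# N" using s N(1) by (intro l_repr_independence)
    then show "x \<in> {x \<in> carrier G. x <# N \<in> (\<lambda>y. y <# N) ` C}" using s by auto
  next
    fix x assume "x \<in> {x \<in> carrier G. x <# N \<in> (\<lambda>y. y <# N) ` C}"
    then obtain y where x: "x \<in> carrier G" and y: "y \<in> C" "x <# N = y <# N" by auto
    have "\<one> \<in> N" using N(1) by (rule subgroup.one_closed)
    then have "y \<otimes> \<one> \<in> y <# N" by (auto simp: l_coset_def)
    then have "y \<in> x <# N" using y C_carrier by auto
    then obtain s where "s \<in> N" "y = x \<otimes> s" by (auto simp: l_coset_def)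
    then show "x \<in> fst ` {z \<in> topspace ?P. fst z \<otimes> snd z \<in> C}"
      unfolding space using x y by (intro image_eqI[of _ _ "(x, s)"]) auto
  qed
  ultimately show ?thesis by simp
qed

text \<open>The fibres are translates of \<open>N\<close>, hence compact. The map is closed because a set of
  cosets is closed in the quotient topology as soon as its union is closed.\<close>

lemma (in topological_group) proper_map_coset:
  assumes "subgroup N G" "compactin T N"
  shows "proper_map T (coset_topology G T N) (\<lambda>x. x <# N)"
  unfolding proper_map_def
proof (intro conjI ballI)
  have quot: "quotient_map T (coset_topology G T N) (\<lambda>x. x <# N)"
    unfolding coset_topology_def by (rule quotient_map_quotient_topology)
  show "closed_map T (coset_topology G T N) (\<lambda>x. x <# N)"
    unfolding closed_map_def
  proof (intro allI impI)
    fix C assume C: "closedin T C"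
    have "(\<lambda>x. x <# N) ` C \<subseteq> topspace (coset_topology G T N)"
      using closedin_subset[OF C] by (auto simp: coset_topology_def topspace_quotient_topology)
    then show "closedin (coset_topology G T N) ((\<lambda>x. x <# N) ` C)"
      using quot closedin_saturation[OF assms C]
      by (simp add: quotient_map_closedin topspace_eq_carrier)
  qed
next
  fix C assume "C \<in> topspace (coset_topology G T N)"
  then obtain y where y: "y \<in> carrier G" "C = y <# N"
    by (auto simp: coset_topology_def topspace_quotient_topology topspace_eq_carrier)
  have "{x \<in> carrier G. x <# N = y <# N} = y <# N"
  proof (intro Set.set_eqI iffI)
    fix x assume x: "x \<in> {x \<in> carrier G. x <# N = y <# N}"
    have "x \<otimes> \<one> \<in> x <# N"
      using subgroup.one_closed[OF assms(1)] by (auto simp: l_coset_def)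
    then show "x \<in> y <# N" using x by auto
  next
    fix x assume "x \<in> y <# N"
    then show "x \<in> {x \<in> carrier G. x <# N = y <# N}"
      using y assms(1) l_repr_independence l_coset_carrier by blast
  qed
  then show "compactin T {x \<in> topspace T. x <# N = C}"
    using compactin_l_coset[OF assms(2) y(1)] by (simp add: y topspace_eq_carrier)
qed

text \<open>The support is a closed subset of the preimage of its own image, and the preimage of a
  compact set under a proper map is compact.\<close>

lemma (in topological_group) covariant_functions_compact_support:
  assumes N: "subgroup N G" "compactin T N" and \<psi>: "\<psi> \<in> covariant_functions G T N \<xi>"
  shows "compactin T (T closure_of {x \<in> carrier G. \<psi> x \<noteq> 0})"
proof -
  let ?S = "T closure_of {x \<in> carrier G. \<psi> x \<noteq> 0}"
  let ?K = "{x \<in> topspace T. x <# N \<in> (\<lambda>x. x <# N) ` ?S}"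
  have "compactin T ?K"
    using \<psi> by (intro compactin_proper_map_preimage[OF proper_map_coset[OF N]])
      (simp add: covariant_functions_def)
  moreover have "?S \<subseteq> ?K" using closure_of_subset_topspace by fastforce
  ultimately show ?thesis using closedin_closure_of by (rule closed_compactin)
qed

section \<open>Borel measures on topological spaces\<close>

lemma space_borel_of: "space (borel_of X) = topspace X"
  unfolding borel_of_def by (subst space_measure_of) (auto dest: openin_subset)

lemma openin_imp_sets_borel_of: "openin X U \<Longrightarrow> U \<in> sets (borel_of X)"
  unfolding borel_of_def
  by (subst sets_measure_of) (auto dest: openin_subset)

lemma closedin_imp_sets_borel_of:
  assumes "closedin X C"
  shows "C \<in> sets (borel_of X)"
proof -
  have "topspace X - (topspace X - C) \<in> sets (borel_of X)"
    using assms openin_imp_sets_borel_of[of X "topspace X - C"]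
      sets.compl_sets[of "topspace X - C" "borel_of X"]
    by (simp add: space_borel_of closedin_def)
  then show ?thesis using closedin_subset[OF assms] by (simp add: double_diff)
qed

lemma left_haar_measure_space: "left_haar_measure G X M \<Longrightarrow> space M = topspace X"
  unfolding left_haar_measure_def radon_measure_def
  using sets_eq_imp_space_eq[of M "borel_of X"] by (simp add: space_borel_of)

lemma borel_measurable_continuous_map:
  fixes f :: "'a \<Rightarrow> 'b :: topological_space"
  assumes "continuous_map X euclidean f" "sets M = sets (borel_of X)"
  shows "f \<in> borel_measurable M"
proof (rule borel_measurableI)
  fix U :: "'b set" assume "open U"
  then have "openin X {x \<in> topspace X. f x \<in> U}"
    using openin_continuous_map_preimage[OF assms(1)] by simp
  moreover have "f -` U \<inter> space M = {x \<in> topspace X. f x \<in> U}"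
    using sets_eq_imp_space_eq[OF assms(2)] by (auto simp: space_borel_of)
  ultimately show "f -` U \<inter> space M \<in> sets M"
    by (simp add: assms(2) openin_imp_sets_borel_of)
qed

lemma integrable_continuous_compact_support:
  fixes f :: "'a \<Rightarrow> 'b :: {banach, second_countable_topology}"
  assumes M: "radon_measure X M" and f: "continuous_map X euclidean f"
    and K: "closedin X K" "compactin X K"
    and zero: "\<And>x. x \<in> topspace X - K \<Longrightarrow> f x = 0"
  shows "integrable M f"
proof -
  have sets: "sets M = sets (borel_of X)" using M by (simp add: radon_measure_def)
  have "compact (f ` K)" using image_compactin[OF K(2) f] by simp
  then have "bounded (f ` K)" by (rule compact_imp_bounded)
  then obtain B where B: "\<And>x. x \<in> K \<Longrightarrow> norm (f x) \<le> B"
    by (auto simp: bounded_iff)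
  show ?thesis
  proof (rule integrableI_bounded_set[of K])
    show "K \<in> sets M" using closedin_imp_sets_borel_of[OF K(1)] sets by simp
    show "f \<in> borel_measurable M" using f sets by (rule borel_measurable_continuous_map)
    show "emeasure M K < \<infinity>" using M K(2) by (simp add: radon_measure_def)
    show "AE x in M. x \<in> K \<longrightarrow> norm (f x) \<le> B" using B by simp
    show "AE x in M. x \<notin> K \<longrightarrow> f x = 0"
      using zero sets_eq_imp_space_eq[OF sets] by (intro AE_I2) (simp add: space_borel_of)
  qed
qed

section \<open>The integrand of the convolution\<close>

lemma (in group) invariant_characters_conj_inv:
  assumes "N \<lhd> G" "\<xi> \<in> invariant_characters G T N" "s \<in> N" "x \<in> carrier G"
  shows "\<xi> s * \<xi> (inv x \<otimes> inv s \<otimes> x) = 1"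
proof -
  have sub: "subgroup N G" using assms(1) by (rule normal_imp_subgroup)
  have inv: "inv s \<in> N" using sub assms(3) by (rule subgroup.m_inv_closed)
  have one: "\<one> \<in> N" using sub by (rule subgroup.one_closed)
  have s: "s \<in> carrier G" using assms(3) subgroup.subset[OF sub] by auto
  have hom: "\<xi> (a \<otimes> b) = \<xi> a * \<xi> b" if "a \<in> N" "b \<in> N" for a b
    using assms(2) that
    by (auto simp: invariant_characters_def characters_def hom_def circle_group_def)
  have "\<xi> \<one> \<noteq> 0"
    using assms(2) one
    by (auto simp: invariant_characters_def characters_def hom_def circle_group_def Pi_iff)
  then have "\<xi> \<one> = 1" using hom[OF one one] by simp
  moreover have "\<xi> (inv x \<otimes> inv s \<otimes> x) = \<xi> (inv s)"
    using assms(2,4) inv by (simp add: invariant_characters_def)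
  ultimately show ?thesis using hom[OF assms(3) inv] s by simp
qed

text \<open>By normality \<open>s\<close> can be moved to the right end of the argument of \<open>\<phi>\<close>, as a conjugate of
  \<open>s\<inverse>\<close>. Invariance of \<open>\<xi>\<close> then makes the two factors produced by covariance cancel.\<close>

lemma (in group) covariant_product_coset_invariant:
  assumes N: "N \<lhd> G" and \<xi>: "\<xi> \<in> invariant_characters G T N"
    and \<psi>: "\<psi> \<in> covariant_functions G T N \<xi>" and \<phi>: "\<phi> \<in> covariant_functions G T N \<xi>"
    and x: "x \<in> carrier G" and y: "y \<in> carrier G" and s: "s \<in> N"
  shows "\<psi> (y \<otimes> s) * \<phi> (inv (y \<otimes> s) \<otimes> x) = \<psi> y * \<phi> (inv y \<otimes> x)"
proof -
  define z where "z = inv y \<otimes> x"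
  define t where "t = inv z \<otimes> inv s \<otimes> z"
  have sub: "subgroup N G" using N by (rule normal_imp_subgroup)
  have z: "z \<in> carrier G" using x y by (simp add: z_def)
  have sG: "s \<in> carrier G" using s subgroup.subset[OF sub] by auto
  have t: "t \<in> N"
    unfolding t_def using N z subgroup.m_inv_closed[OF sub s] by (rule normal.inv_op_closed1)
  have "inv (y \<otimes> s) \<otimes> x = inv s \<otimes> z"
    using x y sG by (simp add: z_def inv_mult_group m_assoc)
  also have "\<dots> = z \<otimes> t"
    using z sG by (simp add: t_def m_assoc[symmetric])
  finally have "\<phi> (inv (y \<otimes> s) \<otimes> x) = \<xi> t * \<phi> z"
    using \<phi> z t by (simp add: covariant_functions_def)
  moreover have "\<psi> (y \<otimes> s) = \<xi> s * \<psi> y"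
    using \<psi> y s by (simp add: covariant_functions_def)
  moreover have "\<xi> s * \<xi> t = 1"
    unfolding t_def using N \<xi> s z by (rule invariant_characters_conj_inv)
  ultimately show ?thesis by (simp add: z_def[symmetric] algebra_simps)
qed

lemma (in topological_group) continuous_map_convolution_integrand:
  fixes \<psi> \<phi> :: "'a \<Rightarrow> 'c :: real_normed_algebra"
  assumes "continuous_map T euclidean \<psi>" "continuous_map T euclidean \<phi>" "x \<in> carrier G"
  shows "continuous_map T euclidean (\<lambda>y. \<psi> y * \<phi> (inv y \<otimes> x))"
proof -
  have "continuous_map T T (\<lambda>y. inv y \<otimes> x)"
    using assms(3) by (intro continuous_map_mult_pair continuous_inv) (simp add: topspace_eq_carrier)
  then have "continuous_map T euclidean (\<lambda>y. \<phi> (inv y \<otimes> x))"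
    using continuous_map_compose[OF _ assms(2)] by (simp add: o_def)
  then show ?thesis using assms(1) by (simp add: continuous_map_atin tendsto_mult)
qed

lemma (in topological_group) integrable_convolution_integrand:
  assumes N: "subgroup N G" "compactin T N" and \<mu>: "left_haar_measure G T \<mu>"
    and \<psi>: "\<psi> \<in> covariant_functions G T N \<xi>" and \<phi>: "continuous_map T euclidean \<phi>"
    and x: "x \<in> carrier G"
  shows "integrable \<mu> (\<lambda>y. \<psi> y * \<phi> (inv y \<otimes> x))"
proof (rule integrable_continuous_compact_support)
  let ?S = "T closure_of {x \<in> carrier G. \<psi> x \<noteq> 0}"
  show "radon_measure T \<mu>" using \<mu> by (simp add: left_haar_measure_def)
  show "continuous_map T euclidean (\<lambda>y. \<psi> y * \<phi> (inv y \<otimes> x))"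
    using \<psi> \<phi> x by (intro continuous_map_convolution_integrand) (auto simp: covariant_functions_def)
  show "closedin T ?S" by simp
  show "compactin T ?S" using N \<psi> by (rule covariant_functions_compact_support)
  fix y assume y: "y \<in> topspace T - ?S"
  have "{x \<in> carrier G. \<psi> x \<noteq> 0} \<subseteq> ?S"
    by (intro closure_of_subset) (auto simp: topspace_eq_carrier)
  then show "\<psi> y * \<phi> (inv y \<otimes> x) = 0" using y by (auto simp: topspace_eq_carrier)
qed

section \<open>Convolution on the group and covariant convolution\<close>

theorem proposition3p6:
  fixes G :: "('a, 'b) monoid_scheme" and T :: "'a topology" and N :: "'a set"
    and \<mu>G \<mu>N :: "'a measure" and \<mu>Q :: "'a set measure"
    and \<xi> \<psi> \<phi> :: "'a \<Rightarrow> complex"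
  assumes "locally_compact_group G T"
    and "N \<lhd> G" and "compactin T N"
    and "left_haar_measure G T \<mu>G"
    and "left_haar_measure (G\<lparr>carrier := N\<rparr>) (subtopology T N) \<mu>N"
    and "left_haar_measure (G Mod N) (coset_topology G T N) \<mu>Q"
    and "weil_formula G \<mu>G \<mu>N \<mu>Q"
    and "\<xi> \<in> invariant_characters G T N"
    and "\<psi> \<in> covariant_functions G T N \<xi>"
    and "\<phi> \<in> covariant_functions G T N \<xi>"
  shows "\<forall>x\<in>carrier G.
    group_convolution G \<mu>G \<psi> \<phi> x =
      complex_of_real (measure \<mu>N N) * covariant_convolution G \<mu>Q \<psi> \<phi> x"
proof
  interpret locally_compact_group G T by (rule assms(1))
  fix x assume x: "x \<in> carrier G"
  define f where "f = (\<lambda>y. \<psi> y * \<phi> (inv\<^bsub>G\<^esub> y \<otimes>\<^bsub>G\<^esub> x))"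
  have sub: "subgroup N G" using assms(2) by (rule normal_imp_subgroup)
  have space_N: "space \<mu>N = N"
    using left_haar_measure_space[OF assms(5)] subgroup.subset[OF sub]
    by (auto simp: topspace_subtopology topspace_eq_carrier)
  have space_Q: "space \<mu>Q = carrier (G Mod N)"
    using left_haar_measure_space[OF assms(6)] topspace_coset_topology[OF assms(2)] by simp
  have int: "integrable \<mu>G f"
    unfolding f_def using assms(10)
    by (intro integrable_convolution_integrand[OF sub assms(3,4,9) _ x])
      (simp add: covariant_functions_def)
  have inner: "(\<integral>s. f (y \<otimes>\<^bsub>G\<^esub> s) \<partial>\<mu>N) = complex_of_real (measure \<mu>N N) * f y"
    if y: "y \<in> carrier G" for y
  proof -
    have "(\<integral>s. f (y \<otimes>\<^bsub>G\<^esub> s) \<partial>\<mu>N) = (\<integral>s. f y \<partial>\<mu>N)"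
      using covariant_product_coset_invariant[OF assms(2,8,9,10) x y]
      by (intro Bochner_Integration.integral_cong) (auto simp: f_def space_N)
    then show ?thesis by (simp add: space_N scaleR_conv_of_real)
  qed
  \<comment> \<open>Both sides evaluate at the same chosen representative of \<open>C\<close>; the choice only has to lie in \<open>G\<close>.\<close>
  have coset: "on_cosets (\<lambda>y. \<integral>s. f (y \<otimes>\<^bsub>G\<^esub> s) \<partial>\<mu>N) C
      = complex_of_real (measure \<mu>N N) * on_cosets f C"
    if C: "C \<in> space \<mu>Q" for C
  proof -
    obtain y where y: "y \<in> carrier G" "C = N #>\<^bsub>G\<^esub> y"
      using C by (auto simp: space_Q FactGroup_def RCOSETS_def)
    have "\<one>\<^bsub>G\<^esub> \<otimes>\<^bsub>G\<^esub> y \<in> C"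
      using subgroup.one_closed[OF sub] by (auto simp: y(2) r_coset_def)
    then have "(SOME y. y \<in> C) \<in> C" by (rule someI)
    then have "(SOME y. y \<in> C) \<in> carrier G"
      using r_coset_subset_G[OF subgroup.subset[OF sub] y(1)] y(2) by auto
    then show ?thesis by (simp add: on_cosets_def inner)
  qed
  have "group_convolution G \<mu>G \<psi> \<phi> x = (\<integral>y. f y \<partial>\<mu>G)"
    by (simp add: group_convolution_def f_def)
  also have "\<dots> = (\<integral>C. on_cosets (\<lambda>y. \<integral>s. f (y \<otimes>\<^bsub>G\<^esub> s) \<partial>\<mu>N) C \<partial>\<mu>Q)"
    using assms(7) int by (simp add: weil_formula_def)
  also have "\<dots> = (\<integral>C. complex_of_real (measure \<mu>N N) * on_cosets f C \<partial>\<mu>Q)"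
    using coset by (intro Bochner_Integration.integral_cong) auto
  also have "\<dots> = complex_of_real (measure \<mu>N N) * covariant_convolution G \<mu>Q \<psi> \<phi> x"
    by (simp add: covariant_convolution_def f_def)
  finally show "group_convolution G \<mu>G \<psi> \<phi> x =
      complex_of_real (measure \<mu>N N) * covariant_convolution G \<mu>Q \<psi> \<phi> x" .
qed

end
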